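(* Let $(A,B,E)$ be an invariant. If $\Phi(A,B,E)$ holds, then $\langle A,B,E\rangle\le\omega_1$.
   Context: An invariant is a triple $(A,B,E)$ such that: (1) $A$ and $B$ are sets of cardinality at most $|\mathbb{R}|$; (2) $E\subseteq A\times B$; (3) for every $a\in A$ there is $b\in B$ with $(a,b)\in E$; (4) for every $b\in B$ there is $a\in A$ with $(a,b)\notin E$. One writes $a\,E\,b$ for $(a,b)\in E$. Its evaluation is $$\langle A,B,E\rangle=\min\{|X|: X\subseteq B\text{ and }(\forall a\in A)(\exists b\in X)\ a\,E\,b\}.$$ $2^{<\omega_1}$ is the set of all functions from a countable ordinal into $2=\{0,1\}$. $\Phi(A,B,E)$ is the statement: for every $F:2^{<\omega_1}\to A$ there is $g:\omega_1\to B$ such that for every $f:\omega_1\to 2$ the set $\{\alpha\in\omega_1: F(f\restriction\alpha)\,E\,g(\alpha)\}$ is stationary in $\omega_1$. *)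

theory Defs
  imports Complex_Main "HOL-Library.FuncSet"
begin

unbundle cardinal_syntax

text \<open>
  Cardinals are represented, as in the library, by cardinal well-orders; \<open>|X|\<close> is the cardinal
  of the set \<open>X\<close>, and cardinals are compared by \<open>\<le>o\<close>.
\<close>

definition is_invariant :: "'a set \<Rightarrow> 'b set \<Rightarrow> ('a \<times> 'b) set \<Rightarrow> bool" where
  "is_invariant A B E \<longleftrightarrow>
     |A| \<le>o |UNIV :: real set| \<and> |B| \<le>o |UNIV :: real set| \<and>
     E \<subseteq> A \<times> B \<and>
     (\<forall>a\<in>A. \<exists>b\<in>B. (a, b) \<in> E) \<and>
     (\<forall>b\<in>B. \<exists>a\<in>A. (a, b) \<notin> E)"

definition dominating_cards :: "'a set \<Rightarrow> 'b set \<Rightarrow> ('a \<times> 'b) set \<Rightarrow> 'b rel set" where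
  "dominating_cards A B E = {|X| | X. X \<subseteq> B \<and> (\<forall>a\<in>A. \<exists>b\<in>X. (a, b) \<in> E)}"

text \<open>
  The minimum of a class of cardinals is unique only up to \<open>=o\<close>, so a representative is chosen.
\<close>

definition evaluation :: "'a set \<Rightarrow> 'b set \<Rightarrow> ('a \<times> 'b) set \<Rightarrow> 'b rel" where
  "evaluation A B E =
     (SOME r. r \<in> dominating_cards A B E \<and> (\<forall>s\<in>dominating_cards A B E. r \<le>o s))"

lemma evaluation_minimum:
  assumes "is_invariant A B E"
  shows "evaluation A B E \<in> dominating_cards A B E"
    and "\<And>s. s \<in> dominating_cards A B E \<Longrightarrow> evaluation A B E \<le>o s"
proof -
  have "|B| \<in> dominating_cards A B E"
    using assms unfolding is_invariant_def dominating_cards_def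
    by (intro CollectI exI [of _ B]) simp
  moreover have "\<forall>r\<in>dominating_cards A B E. Card_order r"
    unfolding dominating_cards_def by (auto simp: card_of_Card_order)
  ultimately have "\<exists>r\<in>dominating_cards A B E. \<forall>s\<in>dominating_cards A B E. r \<le>o s"
    by (intro exists_minim_Card_order) auto
  then have "\<exists>r. r \<in> dominating_cards A B E \<and> (\<forall>s\<in>dominating_cards A B E. r \<le>o s)"
    by (simp only: Bex_def)
  from someI_ex [OF this] have "evaluation A B E \<in> dominating_cards A B E \<and>
      (\<forall>s\<in>dominating_cards A B E. evaluation A B E \<le>o s)"
    unfolding evaluation_def .
  then show "evaluation A B E \<in> dominating_cards A B E"
    and "\<And>s. s \<in> dominating_cards A B E \<Longrightarrow> evaluation A B E \<le>o s"
    by simp_all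
qed

text \<open>
  The successor cardinal of \<open>natLeq\<close> is a well-order of type \<open>\<omega>\<^sub>1\<close>.  The elements of its field
  play the role of the countable ordinals, and \<open>underS omega1 \<alpha>\<close>, the set of strict predecessors
  of \<open>\<alpha>\<close>, that of the von Neumann ordinal \<open>\<alpha>\<close>.
\<close>

definition omega1 :: "nat set rel" where
  "omega1 = cardSuc natLeq"

abbreviation Omega1 :: "nat set set" where
  "Omega1 \<equiv> Field omega1"

text \<open>
  Closedness is tested at each limit \<open>\<delta> < \<omega>\<^sub>1\<close> in which \<open>C\<close> is unbounded; the premises on \<open>\<delta>\<close>
  already force it to be a nonzero limit.
\<close>

definition club :: "nat set set \<Rightarrow> bool" where
  "club C \<longleftrightarrow>
     C \<subseteq> Omega1 \<and>
     (\<forall>\<alpha>\<in>Omega1. \<exists>\<beta>\<in>C. \<alpha> \<in> underS omega1 \<beta>) \<and>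
     (\<forall>\<delta>\<in>Omega1. underS omega1 \<delta> \<noteq> {} \<and>
        (\<forall>\<alpha>\<in>underS omega1 \<delta>. \<exists>\<beta>\<in>C \<inter> underS omega1 \<delta>. \<alpha> \<in> underS omega1 \<beta>) \<longrightarrow> \<delta> \<in> C)"

definition stationary :: "nat set set \<Rightarrow> bool" where
  "stationary S \<longleftrightarrow> S \<subseteq> Omega1 \<and> (\<forall>C. club C \<longrightarrow> S \<inter> C \<noteq> {})"

text \<open>
  Functions from an ordinal \<open>\<le> \<omega>\<^sub>1\<close> into \<open>2\<close> are maps into \<open>bool\<close> whose domain is that ordinal,
  so that a function determines its domain.
\<close>

definition binary_lt_omega1 :: "(nat set \<rightharpoonup> bool) set" where
  "binary_lt_omega1 = {s. \<exists>\<alpha>\<in>Omega1. dom s = underS omega1 \<alpha>}"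

definition Phi :: "'a set \<Rightarrow> 'b set \<Rightarrow> ('a \<times> 'b) set \<Rightarrow> bool" where
  "Phi A B E \<longleftrightarrow>
     (\<forall>F \<in> binary_lt_omega1 \<rightarrow> A. \<exists>g \<in> Omega1 \<rightarrow> B.
        \<forall>f :: nat set \<rightharpoonup> bool. dom f = Omega1 \<longrightarrow>
          stationary {\<alpha> \<in> Omega1. (F (f |` underS omega1 \<alpha>), g \<alpha>) \<in> E})"

end

theory Submission
  imports Defs "HOL-Library.Countable"
begin

text \<open>
  There are at most continuum many elements of \<open>A\<close>, so each of them can be coded by a set of
  natural numbers, and such a set can be written into the first \<open>\<omega>\<close> values of a function
  \<open>f : \<omega>\<^sub>1 \<rightarrow> 2\<close>.  Let \<open>F\<close> decode: it reads the first \<open>\<omega>\<close> values of its argument and returns the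
  element of \<open>A\<close> that they code.  If \<open>f\<close> codes \<open>a\<close>, then \<open>F (f \<restriction> \<alpha>) = a\<close> for every \<open>\<alpha> > \<omega>\<close>
  (\<open>underS_code_space\<close> supplies the \<open>\<omega>\<close> coordinates).  These \<open>\<alpha>\<close> form a club
  (\<open>club_above\<close>), so the stationary set that \<open>\<Phi>\<close> provides for \<open>f\<close> contains one of them, and
  there \<open>a E g \<alpha>\<close>.  Hence the range of the one function \<open>g\<close> guessing for \<open>F\<close> is dominating, and it
  has at most \<open>\<omega>\<^sub>1\<close> elements.
\<close>

lemma omega1_Card_order: "Card_order omega1"
  unfolding omega1_def by (simp add: cardSuc_Card_order natLeq_Card_order)

lemma omega1_Well_order: "Well_order omega1"
  using omega1_Card_order by (rule card_order_on_well_order_on)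

lemma natLeq_ordLess_omega1: "natLeq <o omega1"
  unfolding omega1_def by (rule cardSuc_greater [OF natLeq_Card_order])

lemma omega1_trans: "trans omega1"
  using omega1_Well_order by (simp add: order_on_defs)

lemma omega1_antisym: "antisym omega1"
  using omega1_Well_order by (simp add: order_on_defs)

lemma underS_omega1_trans:
  assumes "\<alpha> \<in> underS omega1 \<beta>" "\<beta> \<in> underS omega1 \<gamma>"
  shows "\<alpha> \<in> underS omega1 \<gamma>"
  using assms omega1_trans omega1_antisym
  by (auto simp: underS_def dest: transD antisymD)

lemma underS_omega1_subset: "underS omega1 \<alpha> \<subseteq> Omega1"
  by (auto simp: underS_def Field_def)

lemma infinite_Omega1: "infinite Omega1"
  unfolding omega1_def
  using cardSuc_finite [OF natLeq_Card_order] by (simp add: Field_natLeq)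

lemma omega1_no_maximum:
  assumes "\<alpha> \<in> Omega1"
  obtains \<beta> where "\<beta> \<in> Omega1" "\<alpha> \<in> underS omega1 \<beta>"
  using infinite_Card_order_limit [OF omega1_Card_order infinite_Omega1 assms]
  by (auto simp: underS_def)

lemma omega1_upper_bound:
  assumes "\<alpha> \<in> Omega1" "\<delta> \<in> Omega1"
  obtains \<beta> where "\<beta> \<in> Omega1" "\<alpha> \<in> underS omega1 \<beta>" "\<delta> \<in> underS omega1 \<beta>"
proof -
  have "\<alpha> = \<delta> \<or> \<alpha> \<in> underS omega1 \<delta> \<or> \<delta> \<in> underS omega1 \<alpha>"
    using omega1_Well_order assms
    by (auto simp: order_on_defs total_on_def underS_def)
  then show thesis
    using that assms by (metis omega1_no_maximum underS_omega1_trans)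
qed

lemma club_above:
  assumes "\<delta> \<in> Omega1"
  shows "club {\<alpha> \<in> Omega1. \<delta> \<in> underS omega1 \<alpha>}"
  unfolding club_def
proof (intro conjI ballI impI)
  fix \<alpha> assume "\<alpha> \<in> Omega1"
  then show "\<exists>\<beta>\<in>{\<alpha> \<in> Omega1. \<delta> \<in> underS omega1 \<alpha>}. \<alpha> \<in> underS omega1 \<beta>"
    using assms by (auto intro: omega1_upper_bound)
qed (auto dest: underS_omega1_trans)

text \<open>
  The ordinal \<open>\<delta>\<close> is the \<open>\<omega>\<close> inside \<open>\<omega>\<^sub>1\<close>: since \<open>\<omega> < \<omega>\<^sub>1\<close>, the order type \<open>\<omega>\<close> is that of a
  proper initial segment.
\<close>

lemma underS_code_space:
  obtains \<delta> and e :: "nat \<Rightarrow> nat set"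
  where "\<delta> \<in> Omega1" "inj e" "range e \<subseteq> underS omega1 \<delta>"
proof -
  obtain \<delta> where \<delta>: "\<delta> \<in> Omega1" "natLeq =o Restr omega1 (underS omega1 \<delta>)"
    using natLeq_ordLess_omega1
      ordLess_iff_ordIso_Restr [OF omega1_Well_order natLeq_Well_order] by auto
  then obtain e where "bij_betw e (Field natLeq) (Field (Restr omega1 (underS omega1 \<delta>)))"
    by (auto simp: ordIso_def iso_def)
  moreover have "Field (Restr omega1 (underS omega1 \<delta>)) \<subseteq> underS omega1 \<delta>"
    by (auto simp: Field_def)
  ultimately have "inj e" "range e \<subseteq> underS omega1 \<delta>"
    by (auto simp: bij_betw_def Field_natLeq)
  with \<delta>(1) show thesis by (rule that)
qed

text \<open>
  A real is determined by the rationals below it, and the rationals are enumerated by the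
  natural numbers.
\<close>

lemma continuum_coding:
  assumes "|A| \<le>o |UNIV :: real set|"
  obtains code :: "'a \<Rightarrow> nat set" where "inj_on code A"
proof -
  obtain x :: "'a \<Rightarrow> real" where x: "inj_on x A"
    using assms by (auto simp flip: card_of_ordLeq)
  define cut :: "real \<Rightarrow> nat set" where "cut r = to_nat ` {q :: rat. of_rat q < r}" for r
  have "cut r \<noteq> cut s" if rs: "r < s" for r s
  proof -
    obtain q where "r < of_rat q" "of_rat q < s"
      using of_rat_dense [OF rs] by auto
    then have "to_nat q \<in> cut s" "to_nat q \<notin> cut r"
      by (auto simp: cut_def)
    then show ?thesis by auto
  qed
  then have "inj cut"
    by (metis injI linorder_neqE)
  with x have "inj_on (cut \<circ> x) A"
    by (meson comp_inj_on inj_on_subset subset_UNIV)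
  then show thesis by (rule that)
qed

lemma evaluation_le_if_dominating:
  assumes "is_invariant A B E" "X \<subseteq> B" "\<And>a. a \<in> A \<Longrightarrow> \<exists>b\<in>X. (a, b) \<in> E"
  shows "evaluation A B E \<le>o |X|"
  using assms(2,3) by (intro evaluation_minimum(2) [OF assms(1)]) (auto simp: dominating_cards_def)

lemma Phi_dominating_family:
  fixes A :: "'a set" and B :: "'b set"
  assumes A: "|A| \<le>o |UNIV :: real set|" and Phi: "Phi A B E" and "A \<noteq> {}"
  obtains g where "g \<in> Omega1 \<rightarrow> B" "\<And>a. a \<in> A \<Longrightarrow> \<exists>\<alpha>\<in>Omega1. (a, g \<alpha>) \<in> E"
proof -
  obtain code :: "'a \<Rightarrow> nat set" where code: "inj_on code A"
    using A by (rule continuum_coding)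
  obtain \<delta> and e :: "nat \<Rightarrow> nat set"
    where \<delta>: "\<delta> \<in> Omega1" and e: "inj e" "range e \<subseteq> underS omega1 \<delta>"
    by (rule underS_code_space)
  obtain a\<^sub>0 where "a\<^sub>0 \<in> A" using \<open>A \<noteq> {}\<close> by auto
  define read :: "(nat set \<rightharpoonup> bool) \<Rightarrow> nat set" where "read s = {n. s (e n) = Some True}" for s
  define F where "F s = (if read s \<in> code ` A then inv_into A code (read s) else a\<^sub>0)" for s
  have "F \<in> binary_lt_omega1 \<rightarrow> A"
    using \<open>a\<^sub>0 \<in> A\<close> by (auto simp: F_def inv_into_into)
  then obtain g where g: "g \<in> Omega1 \<rightarrow> B"
    and guess: "\<And>f :: nat set \<rightharpoonup> bool. dom f = Omega1 \<Longrightarrow>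
      stationary {\<alpha> \<in> Omega1. (F (f |` underS omega1 \<alpha>), g \<alpha>) \<in> E}"
    using Phi unfolding Phi_def by blast
  have "\<exists>\<alpha>\<in>Omega1. (a, g \<alpha>) \<in> E" if a: "a \<in> A" for a
  proof -
    define f :: "nat set \<rightharpoonup> bool"
      where "f \<xi> = (if \<xi> \<in> Omega1 then Some (\<xi> \<in> e ` code a) else None)" for \<xi>
    have "dom f = Omega1" by (auto simp: f_def dom_def)
    from guess [OF this] club_above [OF \<delta>] obtain \<alpha>
      where \<alpha>: "\<alpha> \<in> Omega1" "\<delta> \<in> underS omega1 \<alpha>" "(F (f |` underS omega1 \<alpha>), g \<alpha>) \<in> E"
      unfolding stationary_def by blast
    have visible: "e n \<in> underS omega1 \<alpha>" for n
      using e(2) \<alpha>(2) by (auto intro: underS_omega1_trans)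
    then have "e n \<in> Omega1" for n
      using underS_omega1_subset by blast
    with visible have "read (f |` underS omega1 \<alpha>) = code a"
      by (auto simp: read_def f_def restrict_map_def inj_image_mem_iff [OF e(1)])
    then have "F (f |` underS omega1 \<alpha>) = a"
      using a code by (simp add: F_def inv_into_f_f)
    with \<alpha> show ?thesis by auto
  qed
  with g show thesis by (rule that)
qed

theorem proposition2p5:
  fixes A :: "'a set" and B :: "'b set" and E :: "('a \<times> 'b) set"
  assumes "is_invariant A B E"
    and "Phi A B E"
  shows "evaluation A B E \<le>o omega1"
proof -
  obtain X where X: "X \<subseteq> B" "\<And>a. a \<in> A \<Longrightarrow> \<exists>b\<in>X. (a, b) \<in> E" "|X| \<le>o |Omega1|"
  proof (cases "A = {}")
    \<comment> \<open>The decoding map \<open>F\<close> needs a value in \<open>A\<close>; over the empty set the empty family dominates.\<close>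
    case True
    then show thesis by (intro that [of "{}"]) (simp_all add: card_of_empty)
  next
    case False
    have "|A| \<le>o |UNIV :: real set|"
      using assms(1) by (simp add: is_invariant_def)
    then obtain g where "g \<in> Omega1 \<rightarrow> B" "\<And>a. a \<in> A \<Longrightarrow> \<exists>\<alpha>\<in>Omega1. (a, g \<alpha>) \<in> E"
      using Phi_dominating_family [OF _ assms(2) False] by blast
    then show thesis
      by (intro that [of "g ` Omega1"]) (auto intro: card_of_image)
  qed
  have "evaluation A B E \<le>o |X|"
    using assms(1) X(1,2) by (rule evaluation_le_if_dominating)
  also have "|X| \<le>o |Omega1|" by (rule X(3))
  also have "|Omega1| =o omega1"
    by (rule card_of_Field_ordIso [OF omega1_Card_order])
  finally show ?thesis .
qed

end
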